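(* Let $G=(V,E)$ be a bipartite graph with parts $V_1=\{v_1,\ldots,v_{n_1}\}$ and $V_2=\{v'_1,\ldots,v'_{n_2}\}$, $n_1\le n_2$, $E\subseteq V_1\times V_2$, in which maximum matchings have size $t\le n_1$, and suppose $M:=\{(v_1,v'_1),\ldots,(v_t,v'_t)\}$ is a maximum matching of $G$. Then every allowed edge of type II with respect to $M$ is contained in a left-augmented or a right-augmented alternating path in $G$ with respect to $M$. Conversely, every edge contained in a left-augmented or a right-augmented alternating path with respect to $M$ is allowed.
   Context: A matching is a set of pairwise non-adjacent edges; a maximum matching is one of largest cardinality; an edge is allowed if it belongs to some maximum matching. A node $v_i$ or $v'_i$ is upper if $i\le t$ and lower if $i>t$; an edge $(v_i,v'_j)$ is upper if $i,j\le t$, and lower otherwise. An upper edge is an allowed edge of type I if it is contained in a maximum matching of $G$ consisting only of upper edges; it is an allowed edge of type II if it is allowed but every maximum matching of $G$ containing it also contains a lower edge. A set $P$ of $\ell-1\ge 1$ upper edges is an upper alternating path if there exist $\ell$ distinct indices $1\le i_1,\ldots,i_\ell\le t$ with $P=\{(v_{i_1},v'_{i_2}),(v_{i_2},v'_{i_3}),\ldots,(v_{i_{\ell-1}},v'_{i_\ell})\}\subseteq E$. If moreover $i_0>t$ and $\lambda=(v_{i_0},v'_{i_1})\in E$, then $\{\lambda\}\cup P$ is a left-augmented alternating path; if $i_{\ell+1}>t$ and $\rho=(v_{i_\ell},v'_{i_{\ell+1}})\in E$, then $P\cup\{\rho\}$ is a right-augmented alternating path. *)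

theory Defs
  imports Main
begin

text \<open>
  An edge of a bipartite graph is an ordered pair whose first component lies in the first part
  and whose second component lies in the second part.
\<close>

definition adjacent_edges :: "'a \<times> 'a \<Rightarrow> 'a \<times> 'a \<Rightarrow> bool" where
  "adjacent_edges e f \<longleftrightarrow> {fst e, snd e} \<inter> {fst f, snd f} \<noteq> {}"

definition matching :: "('a \<times> 'a) set \<Rightarrow> ('a \<times> 'a) set \<Rightarrow> bool" where
  "matching E N \<longleftrightarrow> N \<subseteq> E \<and> pairwise (\<lambda>e f. \<not> adjacent_edges e f) N"

text \<open>Cardinalities are meaningful here because the edge set \<open>E\<close> is always finite in use.\<close>

definition maximum_matching :: "('a \<times> 'a) set \<Rightarrow> ('a \<times> 'a) set \<Rightarrow> bool" where
  "maximum_matching E N \<longleftrightarrow> matching E N \<and> (\<forall>N'. matching E N' \<longrightarrow> card N' \<le> card N)"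

definition allowed :: "('a \<times> 'a) set \<Rightarrow> 'a \<times> 'a \<Rightarrow> bool" where
  "allowed E e \<longleftrightarrow> (\<exists>N. maximum_matching E N \<and> e \<in> N)"

text \<open>
  The functions \<open>v\<close> and \<open>v'\<close> enumerate the two parts as \<open>v 1, \<dots>, v n1\<close> and
  \<open>v' 1, \<dots>, v' n2\<close>; their values at other indices are irrelevant. The reference matching
  consists of the edges \<open>(v i, v' i)\<close> for \<open>1 \<le> i \<le> t\<close>, so being upper or lower with respect
  to it is determined by \<open>v\<close>, \<open>v'\<close> and \<open>t\<close>.
\<close>

definition upper_edges ::
    "('a \<times> 'a) set \<Rightarrow> (nat \<Rightarrow> 'a) \<Rightarrow> (nat \<Rightarrow> 'a) \<Rightarrow> nat \<Rightarrow> ('a \<times> 'a) set" where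
  "upper_edges E v v' t = {(v i, v' j) | i j. i \<in> {1..t} \<and> j \<in> {1..t} \<and> (v i, v' j) \<in> E}"

definition lower_edges ::
    "('a \<times> 'a) set \<Rightarrow> (nat \<Rightarrow> 'a) \<Rightarrow> (nat \<Rightarrow> 'a) \<Rightarrow> nat \<Rightarrow> ('a \<times> 'a) set" where
  "lower_edges E v v' t = E - upper_edges E v v' t"

definition allowed_type_II ::
    "('a \<times> 'a) set \<Rightarrow> (nat \<Rightarrow> 'a) \<Rightarrow> (nat \<Rightarrow> 'a) \<Rightarrow> nat \<Rightarrow> 'a \<times> 'a \<Rightarrow> bool" where
  "allowed_type_II E v v' t e \<longleftrightarrow>
     e \<in> upper_edges E v v' t \<and> allowed E e \<and>
     (\<forall>N. maximum_matching E N \<and> e \<in> N \<longrightarrow> N \<inter> lower_edges E v v' t \<noteq> {})"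

text \<open>
  The index sequence \<open>i\<^sub>1, \<dots>, i\<^sub>l\<close> of an alternating path is a list, so that
  \<open>xs ! k\<close> is \<open>i\<^sub>k\<^sub>+\<^sub>1\<close>; the path itself is only the set of its edges outside the reference
  matching.
\<close>

definition path_edges :: "(nat \<Rightarrow> 'a) \<Rightarrow> (nat \<Rightarrow> 'a) \<Rightarrow> nat list \<Rightarrow> ('a \<times> 'a) set" where
  "path_edges v v' xs = {(v (xs ! k), v' (xs ! Suc k)) | k. Suc k < length xs}"

definition upper_alternating_path ::
    "('a \<times> 'a) set \<Rightarrow> (nat \<Rightarrow> 'a) \<Rightarrow> (nat \<Rightarrow> 'a) \<Rightarrow> nat \<Rightarrow> nat list \<Rightarrow> bool" where
  "upper_alternating_path E v v' t xs \<longleftrightarrow>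
     2 \<le> length xs \<and> distinct xs \<and> set xs \<subseteq> {1..t} \<and> path_edges v v' xs \<subseteq> E"

definition left_augmented_path ::
    "('a \<times> 'a) set \<Rightarrow> (nat \<Rightarrow> 'a) \<Rightarrow> (nat \<Rightarrow> 'a) \<Rightarrow> nat \<Rightarrow> nat \<Rightarrow> ('a \<times> 'a) set \<Rightarrow> bool" where
  "left_augmented_path E v v' n1 t Q \<longleftrightarrow>
     (\<exists>xs i. upper_alternating_path E v v' t xs \<and> t < i \<and> i \<le> n1 \<and> (v i, v' (hd xs)) \<in> E \<and>
        Q = {(v i, v' (hd xs))} \<union> path_edges v v' xs)"

definition right_augmented_path ::
    "('a \<times> 'a) set \<Rightarrow> (nat \<Rightarrow> 'a) \<Rightarrow> (nat \<Rightarrow> 'a) \<Rightarrow> nat \<Rightarrow> nat \<Rightarrow> ('a \<times> 'a) set \<Rightarrow> bool" where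
  "right_augmented_path E v v' n2 t Q \<longleftrightarrow>
     (\<exists>xs j. upper_alternating_path E v v' t xs \<and> t < j \<and> j \<le> n2 \<and> (v (last xs), v' j) \<in> E \<and>
        Q = path_edges v v' xs \<union> {(v (last xs), v' j)})"

end

theory Submission
  imports Defs
begin

text \<open>
  Identify an edge \<open>(v i, v' j)\<close> with the pair \<open>(i, j)\<close>; a matching becomes a partial injection
  of indices, and \<open>M\<close> becomes the identity on \<open>{1..t}\<close>. Given an upper edge \<open>(a, b)\<close> with
  \<open>a \<noteq> b\<close> in a maximum matching \<open>R\<close>, take a longest path in \<open>R\<close> through that edge with distinct
  indices in \<open>{1..t}\<close>. If \<open>R\<close> continues it beyond \<open>{1..t}\<close> at one of its ends, we have an augmented
  path. If \<open>R\<close> closes it to a cycle, then exchanging the identity for that cycle gives a maximum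
  matching of upper edges, so the edge is of type I. If \<open>R\<close> meets neither end, then exchanging
  the path for the identity on its indices enlarges \<open>R\<close>. Conversely, exchanging the identity for an
  augmented path keeps the size \<open>t\<close>.
\<close>

section \<open>Paths of indices as sets of consecutive pairs\<close>

text \<open>The zip form makes the sources and targets of a path the plain lists
  \<open>butlast xs\<close> and \<open>tl xs\<close>, so that distinctness of \<open>xs\<close>
  yields injectivity in each coordinate.\<close>

definition steps :: "'b list \<Rightarrow> ('b \<times> 'b) set" where
  "steps xs = set (zip (butlast xs) (tl xs))"

lemma steps_conv_nth: "steps xs = {(xs ! k, xs ! Suc k) | k. Suc k < length xs}"
proof -
  have "(\<exists>k. p = (butlast xs ! k, tl xs ! k) \<and> k < min (length (butlast xs)) (length (tl xs)))
      \<longleftrightarrow> (\<exists>k. p = (xs ! k, xs ! Suc k) \<and> Suc k < length xs)" for p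
    by (intro ex_cong1) (auto simp: nth_butlast nth_tl)
  then show ?thesis
    by (simp add: steps_def set_zip)
qed

lemma fst_steps: "fst ` steps xs = set (butlast xs)"
  unfolding steps_def by (metis length_butlast length_tl list.set_map map_fst_zip)

lemma snd_steps: "snd ` steps xs = set (tl xs)"
  unfolding steps_def by (metis length_butlast length_tl list.set_map map_snd_zip)

lemma inj_on_fst_steps: "distinct xs \<Longrightarrow> inj_on fst (steps xs)"
  unfolding steps_def by (metis distinct_butlast distinct_map length_butlast length_tl map_fst_zip)

lemma inj_on_snd_steps: "distinct xs \<Longrightarrow> inj_on snd (steps xs)"
  unfolding steps_def by (metis distinct_tl distinct_map length_butlast length_tl map_snd_zip)

lemma card_steps: "distinct xs \<Longrightarrow> card (steps xs) = length xs - 1"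
  by (metis card_image distinct_butlast distinct_card fst_steps inj_on_fst_steps length_butlast)

lemma finite_steps: "finite (steps xs)"
  by (simp add: steps_def)

lemma steps_Cons: "xs \<noteq> [] \<Longrightarrow> steps (x # xs) = insert (x, hd xs) (steps xs)"
  by (cases xs) (auto simp: steps_def)

lemma steps_snoc: "xs \<noteq> [] \<Longrightarrow> steps (xs @ [x]) = insert (last xs, x) (steps xs)"
  by (induction xs) (auto simp: steps_Cons hd_append, auto simp: steps_def)

lemma set_butlast_last: "xs \<noteq> [] \<Longrightarrow> set xs = insert (last xs) (set (butlast xs))"
  by (cases xs rule: rev_cases) auto

lemma set_hd_tl: "xs \<noteq> [] \<Longrightarrow> set xs = insert (hd xs) (set (tl xs))"
  by (cases xs) auto

lemma last_notin_butlast: "distinct xs \<Longrightarrow> xs \<noteq> [] \<Longrightarrow> last xs \<notin> set (butlast xs)"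
  by (cases xs rule: rev_cases) auto

lemma hd_notin_tl: "distinct xs \<Longrightarrow> xs \<noteq> [] \<Longrightarrow> hd xs \<notin> set (tl xs)"
  by (cases xs) auto

lemma path_edges_conv_steps: "path_edges v v' xs = map_prod v v' ` steps xs"
  by (auto simp: path_edges_def steps_conv_nth)

lemma steps_subset: "steps xs \<subseteq> set xs \<times> set xs"
  by (auto simp: steps_conv_nth)

section \<open>Longest paths in a partial injection\<close>

text \<open>An end of a longest path that continues in \<open>R\<close> either leaves
  \<open>T\<close> or, by maximality and injectivity, closes the path to a cycle. The last disjunct
  is what remains when neither end continues.\<close>

lemma maximal_path_through:
  assumes fst: "inj_on fst R" and snd: "inj_on snd R" and T: "finite T"
    and ab: "(a, b) \<in> R" "a \<in> T" "b \<in> T" "a \<noteq> b"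
  obtains xs where "distinct xs" "set xs \<subseteq> T" "steps xs \<subseteq> R" "(a, b) \<in> steps xs"
    "(\<exists>w. w \<notin> T \<and> (last xs, w) \<in> R) \<or> (\<exists>w. w \<notin> T \<and> (w, hd xs) \<in> R)
     \<or> (last xs, hd xs) \<in> R \<or> last xs \<notin> fst ` R \<and> hd xs \<notin> snd ` R"
proof -
  define P where "P xs \<longleftrightarrow> distinct xs \<and> set xs \<subseteq> T \<and> steps xs \<subseteq> R \<and> (a, b) \<in> steps xs" for xs
  \<comment> \<open>Here \<open>a \<noteq> b\<close> is what makes the starting list distinct;
    finiteness of \<open>T\<close> then bounds the length of all candidates.\<close>
  have "P [a, b]"
    using ab by (auto simp: P_def steps_def)
  moreover have "length xs < Suc (card T)" if "P xs" for xs
    using that T by (metis P_def card_mono distinct_card less_Suc_eq_le)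
  ultimately obtain xs where xs: "P xs" and max: "\<And>ys. P ys \<Longrightarrow> length ys \<le> length xs"
    using ex_has_greatest_nat[of P "[a, b]" length] by blast
  then have ne: "xs \<noteq> []"
    by (auto simp: P_def steps_def)
  \<comment> \<open>An entry other than the head has a predecessor on the path, which injectivity of
    \<open>snd\<close> would identify with \<open>last xs\<close>, against distinctness. A new index
    would prolong the path.\<close>
  have right: "w = hd xs" if "(last xs, w) \<in> R" "w \<in> T" for w
  proof (rule ccontr)
    assume "w \<noteq> hd xs"
    show False
    proof (cases "w \<in> set xs")
      case True
      then have "w \<in> snd ` steps xs"
        using \<open>w \<noteq> hd xs\<close> ne by (simp add: snd_steps set_hd_tl)
      then obtain u where "(u, w) \<in> steps xs"
        by auto
      moreover from this have "u = last xs"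
        using inj_onD[OF snd, of "(u, w)" "(last xs, w)"] that xs by (auto simp: P_def)
      ultimately have "last xs \<in> fst ` steps xs"
        by force
      then show False
        using last_notin_butlast xs ne by (auto simp: P_def fst_steps)
    next
      case False
      then have "P (xs @ [w])"
        using xs that ne by (auto simp: P_def steps_snoc)
      then show False
        using max by fastforce
    qed
  qed
  have left: "w = last xs" if "(w, hd xs) \<in> R" "w \<in> T" for w
  proof (rule ccontr)
    assume "w \<noteq> last xs"
    show False
    proof (cases "w \<in> set xs")
      case True
      then have "w \<in> fst ` steps xs"
        using \<open>w \<noteq> last xs\<close> ne by (simp add: fst_steps set_butlast_last)
      then obtain u where "(w, u) \<in> steps xs"
        by auto
      moreover from this have "u = hd xs"
        using inj_onD[OF fst, of "(w, u)" "(w, hd xs)"] that xs by (auto simp: P_def)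
      ultimately have "hd xs \<in> snd ` steps xs"
        by force
      then show False
        using hd_notin_tl xs ne by (auto simp: P_def snd_steps)
    next
      case False
      then have "P (w # xs)"
        using xs that ne by (auto simp: P_def steps_Cons)
      then show False
        using max by fastforce
    qed
  qed
  have "(\<exists>w. w \<notin> T \<and> (last xs, w) \<in> R) \<or> (\<exists>w. w \<notin> T \<and> (w, hd xs) \<in> R)
     \<or> (last xs, hd xs) \<in> R \<or> last xs \<notin> fst ` R \<and> hd xs \<notin> snd ` R"
  proof (cases "last xs \<notin> fst ` R \<and> hd xs \<notin> snd ` R")
    case False
    then obtain w where "(last xs, w) \<in> R \<or> (w, hd xs) \<in> R"
      by force
    then show ?thesis
      using left right by blast
  qed blast
  then show thesis
    using that xs unfolding P_def by blast
qed

section \<open>Matchings as partial injections on indices\<close>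

locale enumerated_bipartite =
  fixes E :: "('a \<times> 'a) set" and v v' :: "nat \<Rightarrow> 'a" and n1 n2 t :: nat
  assumes inj_v: "inj_on v {1..n1}" and inj_v': "inj_on v' {1..n2}"
    and disjoint_parts: "v ` {1..n1} \<inter> v' ` {1..n2} = {}"
    and edges: "E \<subseteq> v ` {1..n1} \<times> v' ` {1..n2}"
    and t_le: "t \<le> n1" "t \<le> n2"
    and reference: "maximum_matching E (map_prod v v' ` Id_on {1..t})"
begin

definition index_edges :: "(nat \<times> nat) set" where
  "index_edges = {(i, j) \<in> {1..n1} \<times> {1..n2}. (v i, v' j) \<in> E}"

lemma index_edges_subset: "index_edges \<subseteq> {1..n1} \<times> {1..n2}"
  by (auto simp: index_edges_def)

lemma index_edges_iff:
  "i \<in> {1..n1} \<Longrightarrow> j \<in> {1..n2} \<Longrightarrow> (i, j) \<in> index_edges \<longleftrightarrow> (v i, v' j) \<in> E"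
  by (simp add: index_edges_def)

lemma finite_indices: "A \<subseteq> index_edges \<Longrightarrow> finite A"
  by (rule finite_subset[OF _ finite_subset[OF index_edges_subset]]) auto

lemma inj_on_edge: "inj_on (map_prod v v') index_edges"
  using map_prod_inj_on[OF inj_v inj_v'] index_edges_subset inj_on_subset by blast

lemma card_edge_image: "A \<subseteq> index_edges \<Longrightarrow> card (map_prod v v' ` A) = card A"
  using inj_on_edge by (meson card_image inj_on_subset)

lemma matching_imageI:
  assumes A: "A \<subseteq> index_edges" and inj: "inj_on fst A" "inj_on snd A"
  shows "matching E (map_prod v v' ` A)"
  unfolding matching_def pairwise_def
proof (intro conjI ballI impI)
  show "map_prod v v' ` A \<subseteq> E"
    using A by (auto simp: index_edges_def)
next
  fix e f assume "e \<in> map_prod v v' ` A" "f \<in> map_prod v v' ` A" "e \<noteq> f"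
  then obtain i j k l where ij: "(i, j) \<in> A" "e = (v i, v' j)" and kl: "(k, l) \<in> A" "f = (v k, v' l)"
    and "(i, j) \<noteq> (k, l)"
    by auto
  have "i \<noteq> k"
    using inj_onD[OF inj(1) _ ij(1) kl(1)] \<open>(i, j) \<noteq> (k, l)\<close> by auto
  moreover have "j \<noteq> l"
    using inj_onD[OF inj(2) _ ij(1) kl(1)] \<open>(i, j) \<noteq> (k, l)\<close> by auto
  moreover have range: "i \<in> {1..n1}" "k \<in> {1..n1}" "j \<in> {1..n2}" "l \<in> {1..n2}"
    using A ij kl index_edges_subset by blast+
  ultimately have "v i \<noteq> v k" "v' j \<noteq> v' l"
    using inj_v inj_v' by (meson inj_on_eq_iff)+
  \<comment> \<open>Adjacency compares endpoints regardless of side, so crossed coincidences must be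
    excluded by disjointness of the parts.\<close>
  moreover have "v i \<noteq> v' l" "v k \<noteq> v' j"
    using disjoint_parts range by blast+
  ultimately show "\<not> adjacent_edges e f"
    using ij(2) kl(2) by (auto simp: adjacent_edges_def)
qed

lemma matchingE:
  assumes "matching E N"
  obtains A where "A \<subseteq> index_edges" "inj_on fst A" "inj_on snd A" "N = map_prod v v' ` A"
proof
  define A where "A = {p \<in> index_edges. map_prod v v' p \<in> N}"
  have N: "N \<subseteq> E" and sep: "\<And>e f. e \<in> N \<Longrightarrow> f \<in> N \<Longrightarrow> e \<noteq> f \<Longrightarrow> \<not> adjacent_edges e f"
    using assms by (auto simp: matching_def pairwise_def)
  show sub: "A \<subseteq> index_edges"
    by (auto simp: A_def)
  have *: "p = q" if "p \<in> A" "q \<in> A" "fst p = fst q \<or> snd p = snd q" for p q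
  proof -
    \<comment> \<open>Every edge is adjacent to itself, and a matching separates only distinct
      edges; adjacency within \<open>N\<close> therefore forces equality.\<close>
    have "adjacent_edges (map_prod v v' p) (map_prod v v' q)"
      using that(3) by (cases p; cases q) (auto simp: adjacent_edges_def)
    then have "map_prod v v' p = map_prod v v' q"
      using that(1,2) sep unfolding A_def by blast
    then show ?thesis
      using inj_on_edge sub that(1,2) by (meson inj_on_eq_iff subsetD)
  qed
  show "inj_on fst A" "inj_on snd A"
    using * by (auto intro!: inj_onI)
  show "N = map_prod v v' ` A"
  proof
    show "N \<subseteq> map_prod v v' ` A"
    proof
      fix e assume e: "e \<in> N"
      with N edges obtain i j where ij: "i \<in> {1..n1}" "j \<in> {1..n2}" "e = (v i, v' j)"
        by blast
      then have "(i, j) \<in> A"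
        using e N by (auto simp: A_def index_edges_def)
      then show "e \<in> map_prod v v' ` A"
        using ij by force
    qed
  qed (auto simp: A_def)
qed

lemma Id_on_subset: "Id_on {1..t} \<subseteq> index_edges"
proof -
  have "map_prod v v' ` Id_on {1..t} \<subseteq> E"
    using reference by (simp add: maximum_matching_def matching_def)
  then show ?thesis
    using t_le by (force simp: index_edges_def)
qed

lemma card_reference: "card (map_prod v v' ` Id_on {1..t}) = t"
proof -
  have "Id_on {1..t} = (\<lambda>i. (i, i)) ` {1..t}"
    by auto
  then have "card (Id_on {1..t}) = t"
    by (simp add: card_image inj_on_def)
  then show ?thesis
    using Id_on_subset card_edge_image by metis
qed

lemma card_matching_le: "matching E N \<Longrightarrow> card N \<le> t"
  using reference card_reference by (simp add: maximum_matching_def)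

lemma maximum_matching_iff: "maximum_matching E N \<longleftrightarrow> matching E N \<and> card N = t"
  using reference card_reference card_matching_le
  by (metis dual_order.antisym maximum_matching_def)

section \<open>Exchanging part of the reference matching\<close>

text \<open>The pairs \<open>C\<close> replace the loops on \<open>S\<close>. Indices of
  \<open>C\<close> up to \<open>t\<close> stay in \<open>S\<close>, so the surviving loops are not
  touched, and equal cardinalities keep the size \<open>t\<close>. Indices of \<open>C\<close>
  beyond \<open>t\<close> are permitted, which is what accommodates the augmenting edges.\<close>

lemma maximum_exchange:
  assumes C: "C \<subseteq> index_edges" "inj_on fst C" "inj_on snd C" and S: "S \<subseteq> {1..t}"
    and inter: "fst ` C \<inter> {1..t} \<subseteq> S" "snd ` C \<inter> {1..t} \<subseteq> S" and card: "card C = card S"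
  shows "maximum_matching E (map_prod v v' ` (C \<union> Id_on ({1..t} - S)))"
proof -
  let ?I = "Id_on ({1..t} - S)"
  have I: "?I = (\<lambda>i. (i, i)) ` ({1..t} - S)"
    by auto
  have sub: "C \<union> ?I \<subseteq> index_edges"
    using C(1) Id_on_subset by (auto simp: Id_on_def)
  have "inj_on fst (C \<union> ?I)" "inj_on snd (C \<union> ?I)"
    using C inter unfolding inj_on_Un by (fastforce simp: inj_on_def)+
  then have "matching E (map_prod v v' ` (C \<union> ?I))"
    using sub matching_imageI by blast
  moreover have "card (C \<union> ?I) = card C + card ?I"
    using inter finite_indices[OF sub] by (intro card_Un_disjoint) force+
  moreover have "card ?I = t - card S"
    unfolding I using S by (simp add: card_image inj_on_def card_Diff_subset finite_subset)
  moreover have "card S \<le> t"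
    using S by (metis card_atLeastAtMost card_mono diff_Suc_1 finite_atLeastAtMost)
  ultimately show ?thesis
    using card card_edge_image[OF sub] by (simp add: maximum_matching_iff)
qed

lemma steps_subset_index_edges:
  assumes "set xs \<subseteq> {1..t}" "path_edges v v' xs \<subseteq> E"
  shows "steps xs \<subseteq> index_edges"
  using assms steps_subset[of xs] t_le
  by (force simp: path_edges_conv_steps index_edges_def)

section \<open>Edges of augmented paths are allowed\<close>

text \<open>The steps together with the augmenting pair are as many as the loops on
  \<open>set xs\<close> that they replace: \<open>v i\<close> becomes matched in place of
  \<open>v (last xs)\<close>, while the same vertices of the second part stay covered.\<close>

lemma allowed_left_augmented:
  assumes "left_augmented_path E v v' n1 t Q" "e \<in> Q"
  shows "allowed E e"
proof -
  from assms(1) obtain xs i where xs: "2 \<le> length xs" "distinct xs" "set xs \<subseteq> {1..t}"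
      "path_edges v v' xs \<subseteq> E" and i: "t < i" "i \<le> n1" "(v i, v' (hd xs)) \<in> E"
    and Q: "Q = {(v i, v' (hd xs))} \<union> path_edges v v' xs"
    by (auto simp: left_augmented_path_def upper_alternating_path_def)
  let ?C = "insert (i, hd xs) (steps xs)"
  have ne: "xs \<noteq> []"
    using xs by auto
  have i': "i \<notin> set (butlast xs)" "i \<notin> set xs"
    using i xs in_set_butlastD by fastforce+
  have hd: "hd xs \<in> {1..n2}"
    using xs ne t_le by (meson hd_in_set atLeastAtMost_iff order_trans subsetD)
  have fst: "fst ` ?C = insert i (set (butlast xs))" and snd: "snd ` ?C = set xs"
    using ne by (auto simp: fst_steps snd_steps set_hd_tl)
  have "(i, hd xs) \<in> index_edges"
    using i hd by (simp add: index_edges_iff)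
  then have sub: "?C \<subseteq> index_edges"
    using steps_subset_index_edges xs by simp
  have inj: "inj_on fst ?C" "inj_on snd ?C"
    using inj_on_fst_steps[OF xs(2)] inj_on_snd_steps[OF xs(2)] i' hd_notin_tl[OF xs(2) ne]
    by (auto simp: fst_steps[symmetric] snd_steps[symmetric] image_iff)
  have "maximum_matching E (map_prod v v' ` (?C \<union> Id_on ({1..t} - set xs)))"
  proof (rule maximum_exchange[OF sub inj xs(3)])
    \<comment> \<open>The size is read off from the targets, the coordinate in which
      \<open>?C\<close> covers exactly \<open>set xs\<close>.\<close>
    show "card ?C = card (set xs)"
      using card_image[OF inj(2)] snd by metis
  qed (use fst snd i in \<open>auto dest: in_set_butlastD\<close>)
  moreover have "e \<in> map_prod v v' ` (?C \<union> Id_on ({1..t} - set xs))"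
    using assms(2) Q by (auto simp: path_edges_conv_steps)
  ultimately show ?thesis
    by (auto simp: allowed_def)
qed

text \<open>Mirror image of the left case: \<open>v' j\<close> becomes matched in place of
  \<open>v' (hd xs)\<close>, and now the sources are exactly \<open>set xs\<close>.\<close>

lemma allowed_right_augmented:
  assumes "right_augmented_path E v v' n2 t Q" "e \<in> Q"
  shows "allowed E e"
proof -
  from assms(1) obtain xs j where xs: "2 \<le> length xs" "distinct xs" "set xs \<subseteq> {1..t}"
      "path_edges v v' xs \<subseteq> E" and j: "t < j" "j \<le> n2" "(v (last xs), v' j) \<in> E"
    and Q: "Q = path_edges v v' xs \<union> {(v (last xs), v' j)}"
    by (auto simp: right_augmented_path_def upper_alternating_path_def)
  let ?C = "insert (last xs, j) (steps xs)"
  have ne: "xs \<noteq> []"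
    using xs by auto
  have j': "j \<notin> set (tl xs)" "j \<notin> set xs"
    using j xs list.set_sel(2)[OF ne] by fastforce+
  have last: "last xs \<in> {1..n1}"
    using xs ne t_le by (meson last_in_set atLeastAtMost_iff order_trans subsetD)
  have fst: "fst ` ?C = set xs" and snd: "snd ` ?C = insert j (set (tl xs))"
    using ne by (auto simp: fst_steps snd_steps set_butlast_last)
  have "(last xs, j) \<in> index_edges"
    using j last by (simp add: index_edges_iff)
  then have sub: "?C \<subseteq> index_edges"
    using steps_subset_index_edges xs by simp
  have inj: "inj_on fst ?C" "inj_on snd ?C"
    using inj_on_fst_steps[OF xs(2)] inj_on_snd_steps[OF xs(2)] j' last_notin_butlast[OF xs(2) ne]
    by (auto simp: fst_steps[symmetric] snd_steps[symmetric] image_iff)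
  have "maximum_matching E (map_prod v v' ` (?C \<union> Id_on ({1..t} - set xs)))"
  proof (rule maximum_exchange[OF sub inj xs(3)])
    show "card ?C = card (set xs)"
      using card_image[OF inj(1)] fst by metis
  qed (use fst snd j list.set_sel(2)[OF ne] in auto)
  moreover have "e \<in> map_prod v v' ` (?C \<union> Id_on ({1..t} - set xs))"
    using assms(2) Q by (auto simp: path_edges_conv_steps)
  ultimately show ?thesis
    by (auto simp: allowed_def)
qed

section \<open>Type II edges lie on augmented paths\<close>

text \<open>The closing pair turns the steps into a cyclic permutation of \<open>set xs\<close>,
  which can replace the loops there without using an index beyond \<open>t\<close>. It serves to
  show that an edge on such a cycle is not of type II.\<close>

lemma cycle_in_upper_maximum_matching:
  assumes xs: "xs \<noteq> []" "distinct xs" "set xs \<subseteq> {1..t}"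
    and sub: "insert (last xs, hd xs) (steps xs) \<subseteq> index_edges" (is "?C \<subseteq> _")
  obtains N where "maximum_matching E N" "map_prod v v' ` steps xs \<subseteq> N"
    "N \<subseteq> upper_edges E v v' t"
proof
  have fst: "fst ` ?C = set xs" and snd: "snd ` ?C = set xs"
    using set_butlast_last[OF xs(1)] set_hd_tl[OF xs(1)] by (simp_all add: fst_steps snd_steps)
  have inj: "inj_on fst ?C" "inj_on snd ?C"
    using inj_on_fst_steps[OF xs(2)] inj_on_snd_steps[OF xs(2)]
      last_notin_butlast[OF xs(2,1)] hd_notin_tl[OF xs(2,1)]
    by (auto simp: fst_steps[symmetric] snd_steps[symmetric] image_iff)
  let ?N = "map_prod v v' ` (?C \<union> Id_on ({1..t} - set xs))"
  show max: "maximum_matching E ?N"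
  proof (rule maximum_exchange[OF sub inj xs(3)])
    show "card ?C = card (set xs)"
      using card_image[OF inj(1)] fst by metis
  qed (use fst snd in auto)
  show "map_prod v v' ` steps xs \<subseteq> ?N"
    by auto
  have "?C \<subseteq> {1..t} \<times> {1..t}"
    using steps_subset[of xs] xs(3) last_in_set[OF xs(1)] hd_in_set[OF xs(1)] by blast
  then have "?C \<union> Id_on ({1..t} - set xs) \<subseteq> {1..t} \<times> {1..t}"
    by blast
  moreover have "?N \<subseteq> E"
    using max by (simp add: maximum_matching_def matching_def)
  ultimately show "?N \<subseteq> upper_edges E v v' t"
    unfolding upper_edges_def by fastforce
qed

text \<open>A path on \<open>length xs\<close> indices has one pair fewer than there are loops on
  these indices, so trading its steps for the loops would give a matching of size
  \<open>t + 1\<close>.\<close>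

lemma no_isolated_path:
  assumes R: "R \<subseteq> index_edges" "inj_on fst R" "inj_on snd R" "card R = t"
    and xs: "xs \<noteq> []" "distinct xs" "set xs \<subseteq> {1..t}" "steps xs \<subseteq> R"
    and free: "last xs \<notin> fst ` R" "hd xs \<notin> snd ` R"
  shows False
proof -
  let ?I = "Id_on (set xs)"
  let ?A = "(R - steps xs) \<union> ?I"
  \<comment> \<open>Each entry but the last is the source of a step, so by injectivity no other pair
    of \<open>R\<close> starts there; the last entry starts none by \<open>free\<close>.\<close>
  have fst: "fst ` (R - steps xs) \<inter> set xs = {}"
    using inj_on_image_set_diff[OF R(2) _ xs(4), of R] free(1)
    by (auto simp: fst_steps set_butlast_last[OF xs(1)])
  have snd: "snd ` (R - steps xs) \<inter> set xs = {}"
    using inj_on_image_set_diff[OF R(3) _ xs(4), of R] free(2)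
    by (auto simp: snd_steps set_hd_tl[OF xs(1)])
  have sub: "?A \<subseteq> index_edges"
    using R(1) xs(3) Id_on_subset by auto
  have "inj_on fst ?A" "inj_on snd ?A"
    using R fst snd unfolding inj_on_Un by (fastforce simp: inj_on_def)+
  then have "card ?A \<le> t"
    using sub matching_imageI card_matching_le card_edge_image by metis
  moreover have "card ?A = card (R - steps xs) + card ?I"
    using fst finite_indices[OF sub] by (intro card_Un_disjoint) force+
  moreover have "?I = (\<lambda>i. (i, i)) ` set xs"
    by auto
  then have "card ?I = length xs"
    using xs(2) by (simp add: card_image inj_on_def distinct_card)
  moreover have "card (R - steps xs) = t - (length xs - 1)"
    using R(4) xs by (simp add: card_Diff_subset finite_steps card_steps)
  \<comment> \<open>This bound and \<open>length xs > 0\<close> make the truncated subtractions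
    exact.\<close>
  moreover have "length xs - 1 \<le> t"
    using card_mono[OF finite_indices[OF R(1)] xs(4)] R(4) xs(2) by (simp add: card_steps)
  moreover have "length xs > 0"
    using xs(1) by simp
  ultimately show False
    by linarith
qed

lemma type_II_in_augmented_path:
  assumes "allowed_type_II E v v' t e"
  shows "\<exists>Q. (left_augmented_path E v v' n1 t Q \<or> right_augmented_path E v v' n2 t Q) \<and> e \<in> Q"
proof -
  from assms obtain a b N where ab: "e = (v a, v' b)" "a \<in> {1..t}" "b \<in> {1..t}" "e \<in> E"
    and N: "maximum_matching E N" "e \<in> N"
    and meets: "\<And>N. maximum_matching E N \<Longrightarrow> e \<in> N \<Longrightarrow> N \<inter> lower_edges E v v' t \<noteq> {}"
    by (auto simp: allowed_type_II_def upper_edges_def allowed_def)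
  have not_upper: False
    if "maximum_matching E N'" "e \<in> N'" "N' \<subseteq> upper_edges E v v' t" for N'
    using meets[OF that(1,2)] that(3) by (auto simp: lower_edges_def)
  \<comment> \<open>A loop comes from the reference matching, which consists of upper edges only, so
    \<open>e\<close> would be of type I.\<close>
  have "a \<noteq> b"
  proof
    assume "a = b"
    then have "e \<in> map_prod v v' ` Id_on {1..t}"
      using ab by force
    moreover have "map_prod v v' ` Id_on {1..t} \<subseteq> upper_edges E v v' t"
      using reference unfolding maximum_matching_def matching_def upper_edges_def by blast
    ultimately show False
      using not_upper reference by blast
  qed
  obtain R where R: "R \<subseteq> index_edges" "inj_on fst R" "inj_on snd R" and NR: "N = map_prod v v' ` R"
    using N matchingE by (metis maximum_matching_def)
  have cardR: "card R = t"
    using N NR R card_edge_image by (simp add: maximum_matching_iff)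
  have "(a, b) \<in> R"
  proof -
    \<comment> \<open>The pair representing \<open>e\<close> in \<open>R\<close> is a priori
      unrelated to \<open>(a, b)\<close>; injectivity of the enumerations identifies the
      two.\<close>
    obtain p where p: "p \<in> R" "e = map_prod v v' p"
      using N NR by auto
    have "(a, b) \<in> index_edges"
      using ab t_le by (simp add: index_edges_def)
    then have "p = (a, b)"
      using inj_on_edge R(1) p ab(1) by (metis inj_onD map_prod_simp subsetD)
    then show ?thesis
      using p by simp
  qed
  then obtain xs where xs: "distinct xs" "set xs \<subseteq> {1..t}" "steps xs \<subseteq> R" "(a, b) \<in> steps xs"
    and ends: "(\<exists>w. w \<notin> {1..t} \<and> (last xs, w) \<in> R) \<or> (\<exists>w. w \<notin> {1..t} \<and> (w, hd xs) \<in> R)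
     \<or> (last xs, hd xs) \<in> R \<or> last xs \<notin> fst ` R \<and> hd xs \<notin> snd ` R"
    using maximal_path_through[OF R(2,3), of "{1..t}" a b] ab \<open>a \<noteq> b\<close> by (metis finite_atLeastAtMost)
  have len: "2 \<le> length xs"
    using xs(4) by (auto simp: steps_conv_nth)
  then have ne: "xs \<noteq> []"
    by auto
  have "path_edges v v' xs \<subseteq> E"
    using xs(3) R(1) by (auto simp: path_edges_conv_steps index_edges_def)
  then have up: "upper_alternating_path E v v' t xs"
    using len xs by (simp add: upper_alternating_path_def)
  have e: "e \<in> path_edges v v' xs"
    using xs(4) ab by (force simp: path_edges_conv_steps)
  from ends consider (right) w where "w \<notin> {1..t}" "(last xs, w) \<in> R"
    | (left) w where "w \<notin> {1..t}" "(w, hd xs) \<in> R"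
    | (cycle) "(last xs, hd xs) \<in> R"
    | (isolated) "last xs \<notin> fst ` R" "hd xs \<notin> snd ` R"
    by blast
  then show ?thesis
  proof cases
    case right
    \<comment> \<open>Indices occurring in \<open>R\<close> are positive, so being outside
      \<open>{1..t}\<close> means exceeding \<open>t\<close>.\<close>
    then have "t < w" "w \<le> n2" "(v (last xs), v' w) \<in> E"
      using R(1) by (auto simp: index_edges_def)
    then show ?thesis
      using up e unfolding right_augmented_path_def by blast
  next
    case left
    then have "t < w" "w \<le> n1" "(v w, v' (hd xs)) \<in> E"
      using R(1) by (auto simp: index_edges_def)
    then show ?thesis
      using up e unfolding left_augmented_path_def by blast
  next
    case cycle
    then have "insert (last xs, hd xs) (steps xs) \<subseteq> index_edges"
      using R(1) xs(3) by blast
    then obtain N' where "maximum_matching E N'" "map_prod v v' ` steps xs \<subseteq> N'"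
        "N' \<subseteq> upper_edges E v v' t"
      using cycle_in_upper_maximum_matching[OF ne xs(1,2)] by blast
    then show ?thesis
      using not_upper e by (auto simp: path_edges_conv_steps)
  next
    case isolated
    then show ?thesis
      using no_isolated_path[OF R cardR ne xs(1-3)] by blast
  qed
qed

end

theorem theorem8:
  fixes V1 V2 :: "'a set" and E M :: "('a \<times> 'a) set"
    and v v' :: "nat \<Rightarrow> 'a" and n1 n2 t :: nat
  assumes "V1 = v ` {1..n1}" and "inj_on v {1..n1}"
    and "V2 = v' ` {1..n2}" and "inj_on v' {1..n2}"
    and "V1 \<inter> V2 = {}"
    and "n1 \<le> n2"
    and "E \<subseteq> V1 \<times> V2"
    and "\<And>N. maximum_matching E N \<Longrightarrow> card N = t"
    and "t \<le> n1"
    and "M = {(v i, v' i) | i. i \<in> {1..t}}"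
    and "maximum_matching E M"
  shows "(\<forall>e. allowed_type_II E v v' t e \<longrightarrow>
            (\<exists>Q. (left_augmented_path E v v' n1 t Q \<or> right_augmented_path E v v' n2 t Q) \<and> e \<in> Q))
       \<and> (\<forall>e Q. (left_augmented_path E v v' n1 t Q \<or> right_augmented_path E v v' n2 t Q) \<and> e \<in> Q
            \<longrightarrow> allowed E e)"
proof -
  have "{(v i, v' i) | i. i \<in> {1..t}} = map_prod v v' ` Id_on {1..t}"
    by force
  then have "maximum_matching E (map_prod v v' ` Id_on {1..t})"
    using assms(10,11) by simp
  moreover have "t \<le> n2"
    using assms(6,9) by simp
  ultimately interpret enumerated_bipartite E v v' n1 n2 t
    using assms(2,4,5,7,9) unfolding assms(1,3) by unfold_locales
  show ?thesis
    using type_II_in_augmented_path allowed_left_augmented allowed_right_augmented by blast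
qed

end
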